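(* Let $T\in\mathbb{N}$ be given. Suppose that $\lambda\ge 0$ is small enough that $$I_n-\lambda(\Sigma_y^2)^{-\frac12}R_\beta^{-1}(\Sigma_y^2)^{-\frac12}\succeq 0 .$$ Then there exists a unique solution $\{(P_t,\mathbf{s}_t,c_t)\}_{t\in[T]}$ of the backward recursions $$P_t=M_t-G_tH_t^{-1}G_t^T,$$ $$\mathbf{s}_t=\mathbf{q}_t+A^T\mathbf{s}_{t+1}-G_tH_t^{-1}(\mathbf{r}_t+B^T\mathbf{s}_{t+1}),$$ $$c_t=d_t+c_{t+1}-\tfrac12(\mathbf{r}_t+B^T\mathbf{s}_{t+1})^TH_t^{-1}(\mathbf{r}_t+B^T\mathbf{s}_{t+1})+\tfrac12\mathrm{Tr}\Big(P_{t+1}\begin{bmatrix}\Sigma_z^2&0\\0&\Sigma_y^2\end{bmatrix}\Big),$$ for $t\in[T-1]$, with terminal conditions $$P_T=\begin{bmatrix}T_v&0\\0&0\end{bmatrix},\quad \mathbf{s}_T=\begin{bmatrix}-T_v^T\bar{\mathbf{v}}_T\\0\end{bmatrix},\quad c_T=\tfrac12\bar{\mathbf{v}}_T^TT_v\bar{\mathbf{v}}_T,$$ where $M_t:=Q_t+A^TP_{t+1}A$, $H_t:=R+B^TP_{t+1}B$, $G_t:=N_t+A^TP_{t+1}B$; and the matrix $H_t$ is invertible for every $t\in[T-1]$.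
   Context: Notation: $[N]:=\{0,1,\dots,N\}$; for symmetric matrices, $\succ 0$ (resp. $\succeq 0$) means positive definite (resp. positive semi-definite); for a symmetric positive definite matrix $S$, $S^{\frac12}$ is its symmetric positive definite square root. Data: $n\in\mathbb{N}$, $T\in\mathbb{N}$; $\Sigma_z^2,\Sigma_y^2,R_\alpha,R_\beta,R_v,T_v\in\mathbb{R}^{n\times n}$ are symmetric positive definite ($\Sigma_z^2$, $\Sigma_y^2$ denote covariance matrices); $\bar{\mathbf{v}}_t\in\mathbb{R}^n$ ($t\in[T]$) is a given reference trajectory; $F^b_t,F^c_t\in\mathbb{R}^{n\times n}$ and $\mathbf{f}^d_t\in\mathbb{R}^n$ ($t\in[T-1]$) are given; $\lambda\ge 0$ is a scalar (the deception intensity). Coefficients: $$A:=\begin{bmatrix}I_n&0\\ I_n&I_n\end{bmatrix},\quad B:=I_{2n},\quad R:=\begin{bmatrix}R_\alpha&0\\0&R_\beta\end{bmatrix},$$ $$Q_t:=\begin{bmatrix}R_v+\lambda(F^b_t)^T(\Sigma_y^2)^{-1}F^b_t&\lambda(F^b_t)^T(\Sigma_y^2)^{-1}F^c_t\\ \lambda(F^c_t)^T(\Sigma_y^2)^{-1}F^b_t&\lambda(F^c_t)^T(\Sigma_y^2)^{-1}F^c_t\end{bmatrix},\quad N_t:=\begin{bmatrix}0&-\lambda(F^b_t)^T(\Sigma_y^2)^{-1}\\0&-\lambda(F^c_t)^T(\Sigma_y^2)^{-1}\end{bmatrix},$$ $$\mathbf{q}_t:=\begin{bmatrix}-R_v\bar{\mathbf{v}}_t+\lambda(F^b_t)^T(\Sigma_y^2)^{-1}\mathbf{f}^d_t\\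 \lambda(F^c_t)^T(\Sigma_y^2)^{-1}\mathbf{f}^d_t\end{bmatrix},\quad \mathbf{r}_t:=\begin{bmatrix}0\\-\lambda(\Sigma_y^2)^{-1}\mathbf{f}^d_t\end{bmatrix},\quad d_t:=\tfrac12\bar{\mathbf{v}}_t^TR_v\bar{\mathbf{v}}_t+\tfrac{\lambda}{2}(\mathbf{f}^d_t)^T(\Sigma_y^2)^{-1}\mathbf{f}^d_t .$$ Here $P_t\in\mathbb{R}^{2n\times 2n}$, $\mathbf{s}_t\in\mathbb{R}^{2n}$, $c_t\in\mathbb{R}$. (These recursions arise from a quadratic ansatz $V_t(\mathbf{x})=\frac12\mathbf{x}^TP_t\mathbf{x}+\mathbf{s}_t^T\mathbf{x}+c_t$ for the value function of a discrete-time linear-quadratic control problem.) *)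

theory Defs
  imports "HOL-Analysis.Analysis"
begin

text \<open>In \<open>real ^ 'n ^ 'm\<close> the rows are indexed by \<open>'m\<close> and the columns by \<open>'n\<close>.  The space of
  dimension \<open>2n\<close> is rendered with the index type \<open>'n + 'n\<close>, the first block being the \<open>Inl\<close> part.\<close>

definition block_vec :: "real ^ 'm \<Rightarrow> real ^ 'q \<Rightarrow> real ^ ('m + 'q)" where
  "block_vec u w = (\<chi> i. case i of Inl a \<Rightarrow> u $ a | Inr b \<Rightarrow> w $ b)"

definition block_mat ::
  "real ^ 'n ^ 'm \<Rightarrow> real ^ 'p ^ 'm \<Rightarrow> real ^ 'n ^ 'q \<Rightarrow> real ^ 'p ^ 'q \<Rightarrow> real ^ ('n + 'p) ^ ('m + 'q)" where
  "block_mat K L M N =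
     (\<chi> i. case i of Inl a \<Rightarrow> block_vec (K $ a) (L $ a) | Inr b \<Rightarrow> block_vec (M $ b) (N $ b))"

definition pos_def :: "real ^ 'n ^ 'n \<Rightarrow> bool" where
  "pos_def S \<longleftrightarrow> transpose S = S \<and> (\<forall>x. x \<noteq> 0 \<longrightarrow> x \<bullet> (S *v x) > 0)"

definition pos_semidef :: "real ^ 'n ^ 'n \<Rightarrow> bool" where
  "pos_semidef S \<longleftrightarrow> transpose S = S \<and> (\<forall>x. x \<bullet> (S *v x) \<ge> 0)"

text \<open>Only meaningful for positive definite \<open>S\<close>, where the root exists and is unique.\<close>

definition mat_sqrt :: "real ^ 'n ^ 'n \<Rightarrow> real ^ 'n ^ 'n" where
  "mat_sqrt S = (THE X. pos_def X \<and> X ** X = S)"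

text \<open>\<open>cov_z\<close> and \<open>cov_y\<close> are the covariance matrices \<open>\<Sigma>\<^sub>z\<^sup>2\<close> and \<open>\<Sigma>\<^sub>y\<^sup>2\<close> themselves (not their
  square roots), \<open>v_ref\<close> is the reference trajectory, \<open>lam\<close> the deception intensity.\<close>

record ('n::finite) lq_data =
  cov_z :: "real ^ 'n ^ 'n"
  cov_y :: "real ^ 'n ^ 'n"
  R_alpha :: "real ^ 'n ^ 'n"
  R_beta :: "real ^ 'n ^ 'n"
  R_v :: "real ^ 'n ^ 'n"
  T_v :: "real ^ 'n ^ 'n"
  v_ref :: "nat \<Rightarrow> real ^ 'n"
  F_b :: "nat \<Rightarrow> real ^ 'n ^ 'n"
  F_c :: "nat \<Rightarrow> real ^ 'n ^ 'n"
  f_d :: "nat \<Rightarrow> real ^ 'n"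
  lam :: real

definition A_mat :: "real ^ ('n::finite + 'n) ^ ('n + 'n)" where
  "A_mat = block_mat (mat 1) 0 (mat 1) (mat 1)"

definition B_mat :: "real ^ ('n::finite + 'n) ^ ('n + 'n)" where
  "B_mat = mat 1"

definition R_mat :: "'n::finite lq_data \<Rightarrow> real ^ ('n + 'n) ^ ('n + 'n)" where
  "R_mat p = block_mat (R_alpha p) 0 0 (R_beta p)"

definition Q_mat :: "'n::finite lq_data \<Rightarrow> nat \<Rightarrow> real ^ ('n + 'n) ^ ('n + 'n)" where
  "Q_mat p t = block_mat
     (R_v p + lam p *\<^sub>R (transpose (F_b p t) ** matrix_inv (cov_y p) ** F_b p t))
     (lam p *\<^sub>R (transpose (F_b p t) ** matrix_inv (cov_y p) ** F_c p t))
     (lam p *\<^sub>R (transpose (F_c p t) ** matrix_inv (cov_y p) ** F_b p t))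
     (lam p *\<^sub>R (transpose (F_c p t) ** matrix_inv (cov_y p) ** F_c p t))"

definition N_mat :: "'n::finite lq_data \<Rightarrow> nat \<Rightarrow> real ^ ('n + 'n) ^ ('n + 'n)" where
  "N_mat p t = block_mat
     0 (- (lam p *\<^sub>R (transpose (F_b p t) ** matrix_inv (cov_y p))))
     0 (- (lam p *\<^sub>R (transpose (F_c p t) ** matrix_inv (cov_y p))))"

definition q_vec :: "'n::finite lq_data \<Rightarrow> nat \<Rightarrow> real ^ ('n + 'n)" where
  "q_vec p t = block_vec
     (- (R_v p *v v_ref p t)
        + lam p *\<^sub>R ((transpose (F_b p t) ** matrix_inv (cov_y p)) *v f_d p t))
     (lam p *\<^sub>R ((transpose (F_c p t) ** matrix_inv (cov_y p)) *v f_d p t))"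

definition r_vec :: "'n::finite lq_data \<Rightarrow> nat \<Rightarrow> real ^ ('n + 'n)" where
  "r_vec p t = block_vec 0 (- (lam p *\<^sub>R (matrix_inv (cov_y p) *v f_d p t)))"

definition d_coeff :: "'n::finite lq_data \<Rightarrow> nat \<Rightarrow> real" where
  "d_coeff p t = 1/2 * (v_ref p t \<bullet> (R_v p *v v_ref p t))
     + lam p / 2 * (f_d p t \<bullet> (matrix_inv (cov_y p) *v f_d p t))"

text \<open>In the next three definitions \<open>P'\<close> stands for \<open>P\<^sub>t\<^sub>+\<^sub>1\<close>.\<close>

definition M_mat ::
  "'n::finite lq_data \<Rightarrow> nat \<Rightarrow> real ^ ('n + 'n) ^ ('n + 'n) \<Rightarrow> real ^ ('n + 'n) ^ ('n + 'n)" where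
  "M_mat p t P' = Q_mat p t + transpose A_mat ** P' ** A_mat"

definition H_mat ::
  "'n::finite lq_data \<Rightarrow> real ^ ('n + 'n) ^ ('n + 'n) \<Rightarrow> real ^ ('n + 'n) ^ ('n + 'n)" where
  "H_mat p P' = R_mat p + transpose B_mat ** P' ** B_mat"

definition G_mat ::
  "'n::finite lq_data \<Rightarrow> nat \<Rightarrow> real ^ ('n + 'n) ^ ('n + 'n) \<Rightarrow> real ^ ('n + 'n) ^ ('n + 'n)" where
  "G_mat p t P' = N_mat p t + transpose A_mat ** P' ** B_mat"

text \<open>Only the values of \<open>P\<close>, \<open>s\<close>, \<open>c\<close> at times \<open>t \<le> T\<close> are constrained.  The library constant
  \<open>matrix_inv\<close> is total and unspecified on singular matrices, so the equations alone do not express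
  that the \<open>H\<^sub>t\<close> are invertible.\<close>

definition backward_solution ::
  "'n::finite lq_data \<Rightarrow> nat \<Rightarrow> (nat \<Rightarrow> real ^ ('n + 'n) ^ ('n + 'n)) \<Rightarrow>
   (nat \<Rightarrow> real ^ ('n + 'n)) \<Rightarrow> (nat \<Rightarrow> real) \<Rightarrow> bool" where
  "backward_solution p T P s c \<longleftrightarrow>
     P T = block_mat (T_v p) 0 0 0 \<and>
     s T = block_vec (- (transpose (T_v p) *v v_ref p T)) 0 \<and>
     c T = 1/2 * (v_ref p T \<bullet> (T_v p *v v_ref p T)) \<and>
     (\<forall>t<T.
        let P' = P (t + 1);
            G = G_mat p t P';
            Hinv = matrix_inv (H_mat p P');
            w = r_vec p t + transpose B_mat *v s (t + 1)
        in
          P t = M_mat p t P' - G ** Hinv ** transpose G \<and>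
          s t = q_vec p t + transpose A_mat *v s (t + 1) - (G ** Hinv) *v w \<and>
          c t = d_coeff p t + c (t + 1) - 1/2 * (w \<bullet> (Hinv *v w))
                + 1/2 * trace (P' ** block_mat (cov_z p) 0 0 (cov_y p)))"

end

theory Submission
  imports Defs
begin

text \<open>The recursions run backwards from time \<open>T\<close> and express the values at time \<open>t\<close> through those at
  \<open>t + 1\<close>, so they always have exactly one solution once the inverse of \<open>H\<^sub>t\<close> is read as a total
  function.  The content is that \<open>H\<^sub>t\<close> is invertible.  As \<open>H\<^sub>t = R + P\<^sub>t\<^sub>+\<^sub>1\<close> (\<open>B\<close> is the identity)
  with \<open>R\<close> positive definite, it suffices that every \<open>P\<^sub>t\<close> is positive semidefinite, and this is
  shown by induction from \<open>T\<close> downwards.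

  For the induction step, the matrix \<open>P\<^sub>t = M\<^sub>t - G\<^sub>t H\<^sub>t\<^sup>-\<^sup>1 G\<^sub>t\<^sup>T\<close> is a Schur complement: its quadratic
  form at \<open>x\<close> is the minimum over controls \<open>u\<close> of the stage cost plus the cost to go,
  \<open>(x \<bullet> Q\<^sub>t x + 2 x \<bullet> N\<^sub>t u + u \<bullet> R u) + (A x + B u) \<bullet> P\<^sub>t\<^sub>+\<^sub>1 (A x + B u)\<close>.
  The last term is nonnegative by induction hypothesis.  With \<open>x = (v, b)\<close>, \<open>u = (\<alpha>, \<beta>)\<close>,
  \<open>W = (\<Sigma>\<^sub>y\<^sup>2)\<^sup>-\<^sup>1\<close> and \<open>z = F\<^sup>b v + F\<^sup>c b\<close>, completing the square turns the stage cost into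
  \<open>v \<bullet> R\<^sub>v v + \<alpha> \<bullet> R\<^sub>\<alpha> \<alpha> + \<lambda> (z - \<beta>) \<bullet> W (z - \<beta>) + \<beta> \<bullet> (R\<^sub>\<beta> - \<lambda> W) \<beta>\<close>,
  so all that is needed is \<open>\<lambda> W \<le> R\<^sub>\<beta>\<close> (\<open>stage_cost_nonneg\<close>).  The assumption on \<open>\<lambda>\<close> gives this by
  another completed square (\<open>deception_cost_le_control_cost\<close>); the Schur complement and the
  induction step are \<open>pos_semidef_schur_complement\<close> and \<open>pos_semidef_riccati_step\<close>.

  The assumption speaks of the square root of \<open>\<Sigma>\<^sub>y\<^sup>2\<close>, which is defined by a definite description,
  so its existence and uniqueness have to be established first (\<open>mat_sqrt\<close>).  Existence comes
  from the contraction principle (\<open>symmetric_contraction_sqrt\<close>) and uniqueness from a trace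
  argument (\<open>pos_def_sqrt_unique\<close>).\<close>

\<comment> \<open>Transposes are moved across the inner product by \<open>inner_transpose_mult\<close>, so products with
  them must not be rewritten to products of a row vector with a matrix.\<close>
declare transpose_matrix_vector [simp del]

section \<open>Symmetric matrices and quadratic forms\<close>

lemma inner_transpose_mult:
  fixes A :: "real ^ 'n ^ 'm"
  shows "x \<bullet> (transpose A *v y) = (A *v x) \<bullet> y"
  by (metis dot_lmul_matrix inner_commute transpose_matrix_vector)

lemma inner_symmetric_mult:
  fixes S :: "real ^ 'n ^ 'n"
  assumes "transpose S = S"
  shows "x \<bullet> (S *v y) = (S *v x) \<bullet> y"
  using inner_transpose_mult[of x S y] assms by simp

lemma transpose_add: "transpose (A + B) = transpose A + transpose B"
  by (simp add: transpose_def vec_eq_iff)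

lemma transpose_diff: "transpose (A - B) = transpose A - transpose B"
  by (simp add: transpose_def vec_eq_iff)

lemma matrix_inv_cancel:
  fixes S :: "real ^ 'n ^ 'n"
  assumes "invertible S"
  shows "S ** matrix_inv S = mat 1" and "matrix_inv S ** S = mat 1"
proof -
  have "S ** matrix_inv S = mat 1 \<and> matrix_inv S ** S = mat 1"
    using assms unfolding invertible_def matrix_inv_def by (rule someI_ex)
  then show "S ** matrix_inv S = mat 1" and "matrix_inv S ** S = mat 1" by auto
qed

lemma transpose_matrix_inv:
  fixes S :: "real ^ 'n ^ 'n"
  assumes "invertible S" and "transpose S = S"
  shows "transpose (matrix_inv S) = matrix_inv S"
proof -
  have "transpose (matrix_inv S) ** S = mat 1"
    using matrix_inv_cancel(1)[OF assms(1)] assms(2)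
    by (metis matrix_transpose_mul transpose_mat)
  then have "transpose (matrix_inv S) ** S ** matrix_inv S = matrix_inv S"
    by simp
  then show ?thesis
    by (simp add: matrix_mul_assoc[symmetric] matrix_inv_cancel(1)[OF assms(1)])
qed

lemma pos_def_sym: "pos_def S \<Longrightarrow> transpose S = S"
  by (simp add: pos_def_def)

lemma pos_def_imp_pos_semidef:
  assumes "pos_def S"
  shows "pos_semidef S"
  unfolding pos_semidef_def
proof (intro conjI allI)
  show "transpose S = S" using assms by (rule pos_def_sym)
  show "x \<bullet> (S *v x) \<ge> 0" for x
    using assms by (cases "x = 0") (auto simp: pos_def_def less_imp_le)
qed

lemma pos_def_add_pos_semidef:
  assumes "pos_def S" and "pos_semidef P"
  shows "pos_def (S + P)"
  using assms
  by (auto simp: pos_def_def pos_semidef_def transpose_add matrix_vector_mult_add_rdistrib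
      inner_add_right intro: add_pos_nonneg)

lemma pos_def_invertible:
  fixes S :: "real ^ 'n ^ 'n"
  assumes "pos_def S"
  shows "invertible S"
proof -
  have "x = 0" if "S *v x = 0" for x
    using assms that unfolding pos_def_def by force
  then show ?thesis
    using matrix_left_invertible_ker[of S] invertible_left_inverse[of S] by blast
qed

lemma pos_def_matrix_inv:
  fixes S :: "real ^ 'n ^ 'n"
  assumes "pos_def S"
  shows "pos_def (matrix_inv S)"
  unfolding pos_def_def
proof (intro conjI allI impI)
  note inv = pos_def_invertible[OF assms]
  show "transpose (matrix_inv S) = matrix_inv S"
    using transpose_matrix_inv[OF inv pos_def_sym[OF assms]] .
  fix x :: "real ^ 'n" assume "x \<noteq> 0"
  define y where "y = matrix_inv S *v x"
  \<comment> \<open>the value of the inverse form at \<open>S *v y\<close> is the value of the original form at \<open>y\<close>\<close>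
  have x: "x = S *v y"
    by (simp add: y_def matrix_vector_mul_assoc matrix_inv_cancel[OF inv])
  with \<open>x \<noteq> 0\<close> have "y \<noteq> 0" by auto
  then have "y \<bullet> x > 0" using assms by (simp add: x pos_def_def)
  then show "x \<bullet> (matrix_inv S *v x) > 0"
    by (simp add: y_def inner_commute)
qed

section \<open>The square root of a positive definite matrix\<close>

lemma trace_eq_sum_axis:
  fixes A :: "real ^ 'n ^ 'n"
  shows "trace A = (\<Sum>i\<in>UNIV. axis i 1 \<bullet> (A *v axis i 1))"
  by (simp add: trace_def inner_axis' matrix_vector_mult_basis column_def)

text \<open>The trace of \<open>D X D\<close> is the sum of the values of the form of \<open>X\<close> at the columns of \<open>D\<close>.\<close>

lemma trace_conj_pos_def:
  fixes X D :: "real ^ 'n ^ 'n"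
  assumes X: "pos_def X" and D: "transpose D = D"
  shows "trace (D ** X ** D) \<ge> 0"
    and "trace (D ** X ** D) = 0 \<Longrightarrow> D = 0"
proof -
  define q where "q i = (D *v axis i 1) \<bullet> (X *v (D *v axis i 1))" for i
  have tr: "trace (D ** X ** D) = (\<Sum>i\<in>UNIV. q i)"
    unfolding trace_eq_sum_axis q_def
    by (simp add: matrix_vector_mul_assoc[symmetric] inner_symmetric_mult[OF D])
  have q0: "q i \<ge> 0" for i
    using pos_def_imp_pos_semidef[OF X] by (simp add: q_def pos_semidef_def)
  show "trace (D ** X ** D) \<ge> 0" unfolding tr by (intro sum_nonneg q0)
  assume "trace (D ** X ** D) = 0"
  then have "\<forall>i. q i = 0" using tr q0 by (simp add: sum_nonneg_eq_0_iff)
  then have "D *v axis i 1 = 0" for i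
    using X unfolding q_def pos_def_def by (metis less_irrefl)
  then have "column i D = 0" for i by (simp add: matrix_vector_mult_basis)
  then show "D = 0" by (simp add: vec_eq_iff column_def)
qed

text \<open>For \<open>D = X - Y\<close> one has \<open>X D + D Y = X\<^sup>2 - Y\<^sup>2 = 0\<close>, even if \<open>X\<close> and \<open>Y\<close> do not commute.
  Multiplying by \<open>D\<close> and taking traces yields \<open>tr (D X D) + tr (D Y D) = 0\<close>, a sum of two
  nonnegative numbers, the first of which vanishes only for \<open>D = 0\<close>.\<close>

lemma pos_def_sqrt_unique:
  fixes X Y :: "real ^ 'n ^ 'n"
  assumes X: "pos_def X" and Y: "pos_def Y" and eq: "X ** X = Y ** Y"
  shows "X = Y"
proof -
  define D where "D = X - Y"
  have D: "transpose D = D"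
    by (simp add: D_def transpose_diff pos_def_sym[OF X] pos_def_sym[OF Y])
  have "X ** D + D ** Y = 0"
    unfolding D_def using eq
    by (simp add: vec_eq_iff matrix_matrix_mult_def sum_subtractf algebra_simps)
  then have "D ** (X ** D + D ** Y) = 0"
    by (simp add: matrix_matrix_mult_def vec_eq_iff)
  then have "trace (D ** X ** D + D ** (D ** Y)) = 0"
    by (simp add: matrix_add_ldistrib matrix_mul_assoc trace_def)
  moreover have "trace (D ** (D ** Y)) = trace (D ** Y ** D)"
    by (simp only: trace_mul_sym[of D "D ** Y"])
  ultimately have "trace (D ** X ** D) + trace (D ** Y ** D) = 0"
    by (simp add: trace_add)
  then have "trace (D ** X ** D) = 0"
    using trace_conj_pos_def(1)[OF X D] trace_conj_pos_def(1)[OF Y D] by linarith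
  then have "D = 0" by (rule trace_conj_pos_def(2)[OF X D])
  then show ?thesis by (simp add: D_def)
qed

text \<open>By compactness the form attains a minimum on the unit sphere; that minimum is the constant.\<close>

lemma pos_def_coercive:
  fixes S :: "real ^ 'n ^ 'n"
  assumes "pos_def S"
  obtains m where "m > 0" and "\<And>x. x \<bullet> (S *v x) \<ge> m * (norm x)\<^sup>2"
proof -
  have cont: "continuous_on (sphere 0 1) (\<lambda>x. x \<bullet> (S *v x))"
    by (intro continuous_intros matrix_vector_mult_linear_continuous_on)
  have "sphere (0 :: real ^ 'n) 1 \<noteq> {}" by simp
  then obtain x0 where x0: "x0 \<in> sphere 0 1"
    and min: "\<And>x. x \<in> sphere 0 1 \<Longrightarrow> x0 \<bullet> (S *v x0) \<le> x \<bullet> (S *v x)"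
    using continuous_attains_inf[OF compact_sphere _ cont] by blast
  show thesis
  proof (rule that)
    have "x0 \<noteq> 0" using x0 by auto
    then show "x0 \<bullet> (S *v x0) > 0" using assms by (simp add: pos_def_def)
    show "x \<bullet> (S *v x) \<ge> (x0 \<bullet> (S *v x0)) * (norm x)\<^sup>2" for x
    proof (cases "x = 0")
      case False
      then have "x0 \<bullet> (S *v x0) \<le> (x /\<^sub>R norm x) \<bullet> (S *v (x /\<^sub>R norm x))"
        by (intro min) simp
      then have "x0 \<bullet> (S *v x0) \<le> (x \<bullet> (S *v x)) / (norm x)\<^sup>2"
        by (simp add: matrix_vector_mult_scaleR power2_eq_square divide_simps)
      with False show ?thesis by (simp add: field_simps)
    qed simp
  qed
qed

text \<open>If \<open>2 Y = B + Y\<^sup>2\<close>, then \<open>1 - Y\<close> is a square root of \<open>1 - B\<close>.  Such a \<open>Y\<close> is a fixed point of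
  \<open>Y \<mapsto> (B + Y\<^sup>2) / 2\<close>, which maps the closed ball of radius \<open>norm B < 1\<close> into itself.  It contracts
  there with factor \<open>norm B\<close>, since \<open>Y\<^sup>2 - Z\<^sup>2 = Y (Y - Z) + (Y - Z) Z\<close>.  The symmetric operators form a
  closed subset that is invariant under the map, so the fixed point is symmetric.\<close>

lemma symmetric_contraction_sqrt:
  fixes B :: "'a::{real_inner, banach} \<Rightarrow>\<^sub>L 'a"
  assumes B: "norm B < 1" and sym: "\<And>x y. x \<bullet> B y = B x \<bullet> y"
  obtains Y :: "'a \<Rightarrow>\<^sub>L 'a"
    where "norm Y < 1" and "\<And>x y. x \<bullet> Y y = Y x \<bullet> y"
      and "\<And>x. 2 *\<^sub>R Y x = B x + Y (Y x)"
proof -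
  define K where "K = {Y :: 'a \<Rightarrow>\<^sub>L 'a. norm Y \<le> norm B} \<inter> {Y. \<forall>x y. x \<bullet> blinfun_apply Y y = Y x \<bullet> y}"
  define f where "f Y = (1/2) *\<^sub>R (B + (Y o\<^sub>L Y))" for Y
  have "closed K"
    unfolding K_def by (intro closed_Int closed_Collect_le closed_Collect_all closed_Collect_eq
        continuous_intros)
  then have "complete K" by (simp add: complete_eq_closed)
  moreover have "K \<noteq> {}" using sym by (auto simp: K_def)
  moreover have "f ` K \<subseteq> K"
  proof (rule image_subsetI)
    fix Y assume Y: "Y \<in> K"
    then have nY: "norm Y \<le> norm B" and sY: "\<And>x y. x \<bullet> Y y = Y x \<bullet> y"
      by (auto simp: K_def)
    have "norm (Y o\<^sub>L Y) \<le> norm B * norm B"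
      by (rule order_trans[OF norm_blinfun_compose]) (intro mult_mono nY norm_ge_zero)
    also have "\<dots> \<le> norm B" using B by (simp add: mult_left_le)
    finally have "norm (B + (Y o\<^sub>L Y)) \<le> 2 * norm B"
      using norm_triangle_ineq[of B "Y o\<^sub>L Y"] by linarith
    then have "norm (f Y) \<le> norm B" by (simp add: f_def)
    moreover have "x \<bullet> f Y y = f Y x \<bullet> y" for x y
      using sym[of x y] sY[of x "Y y"] sY[of "Y x" y]
      by (simp add: f_def blinfun.bilinear_simps inner_add_left inner_add_right)
    ultimately show "f Y \<in> K" by (simp add: K_def)
  qed
  moreover have "dist (f Y) (f Z) \<le> norm B * dist Y Z" if "Y \<in> K" "Z \<in> K" for Y Z
  proof -
    have n: "norm Y \<le> norm B" "norm Z \<le> norm B" using that by (auto simp: K_def)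
    have "f Y - f Z = (1/2) *\<^sub>R ((Y o\<^sub>L (Y - Z)) + ((Y - Z) o\<^sub>L Z))"
      by (rule blinfun_eqI) (simp add: f_def blinfun.bilinear_simps algebra_simps)
    then have "norm (f Y - f Z) = (1/2) * norm ((Y o\<^sub>L (Y - Z)) + ((Y - Z) o\<^sub>L Z))"
      by simp
    also have "\<dots> \<le> (1/2) * (norm (Y o\<^sub>L (Y - Z)) + norm ((Y - Z) o\<^sub>L Z))"
      by (intro mult_left_mono norm_triangle_ineq) simp
    also have "\<dots> \<le> (1/2) * (norm Y * norm (Y - Z) + norm (Y - Z) * norm Z)"
      by (intro mult_left_mono add_mono norm_blinfun_compose) simp
    also have "\<dots> \<le> (1/2) * (norm B * norm (Y - Z) + norm (Y - Z) * norm B)"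
      by (intro mult_left_mono mult_right_mono add_mono n norm_ge_zero) simp
    finally show ?thesis by (simp add: dist_norm mult.commute)
  qed
  ultimately obtain Y where Y: "Y \<in> K" "f Y = Y"
    using Banach_fix[of K "norm B" f] B by auto
  show thesis
  proof (rule that[of Y])
    show "norm Y < 1" "x \<bullet> Y y = Y x \<bullet> y" for x y using Y(1) B by (auto simp: K_def)
    show "2 *\<^sub>R Y x = B x + Y (Y x)" for x
    proof -
      have "2 *\<^sub>R Y x = 2 *\<^sub>R f Y x" by (simp only: Y(2))
      then show ?thesis by (simp add: f_def blinfun.bilinear_simps)
    qed
  qed
qed

text \<open>For small \<open>c > 0\<close> the operator \<open>B = 1 - c S\<close> has norm less than \<open>1\<close>, so that \<open>c S = 1 - B\<close> has the
  symmetric square root \<open>1 - Y\<close>, where \<open>norm Y < 1\<close> makes \<open>1 - Y\<close> positive definite.  Rescaling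
  by \<open>sqrt c\<close> gives the root of \<open>S\<close>.\<close>

lemma pos_def_sqrt_exists:
  fixes S :: "real ^ 'n ^ 'n"
  assumes S: "pos_def S"
  shows "\<exists>X. pos_def X \<and> X ** X = S"
proof -
  obtain m where m: "m > 0" "\<And>x. x \<bullet> (S *v x) \<ge> m * (norm x)\<^sup>2"
    using pos_def_coercive[OF S] by blast
  have "bounded_linear ((*v) S)" by (rule matrix_vector_mul_bounded_linear)
  then obtain k where k: "k > 0" "\<And>x. norm (S *v x) \<le> norm x * k"
    using bounded_linear.pos_bounded by blast
  \<comment> \<open>this \<open>c\<close> minimizes \<open>1 - 2 * c * m + c\<^sup>2 * k\<^sup>2\<close>, which bounds the squared norm of \<open>B\<close>\<close>
  define c where "c = m / k\<^sup>2"
  define \<rho> where "\<rho> = sqrt (max 0 (1 - m\<^sup>2 / k\<^sup>2))"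
  have c: "c > 0" using m k by (simp add: c_def)
  have \<rho>: "0 \<le> \<rho>" "\<rho> < 1" using m k by (auto simp: \<rho>_def max_def)
  define B where "B = Blinfun (\<lambda>x. x - c *\<^sub>R (S *v x))"
  have B: "B x = x - c *\<^sub>R (S *v x)" for x
    unfolding B_def
    by (subst bounded_linear_Blinfun_apply)
      (auto intro!: bounded_linear_intros matrix_vector_mul_bounded_linear)
  have "norm (B x) \<le> \<rho> * norm x" for x
  proof (rule power2_le_imp_le)
    have "(norm (S *v x))\<^sup>2 \<le> (norm x * k)\<^sup>2" using k by (intro power_mono) auto
    then have "c\<^sup>2 * (norm (S *v x))\<^sup>2 \<le> c\<^sup>2 * (norm x * k)\<^sup>2" by (rule mult_left_mono) simp
    moreover have "c * (x \<bullet> (S *v x)) \<ge> c * (m * (norm x)\<^sup>2)"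
      using m(2)[of x] c by (intro mult_left_mono) auto
    moreover have "(norm (B x))\<^sup>2 = (norm x)\<^sup>2 - 2 * (c * (x \<bullet> (S *v x))) + c\<^sup>2 * (norm (S *v x))\<^sup>2"
      unfolding B power2_norm_eq_inner
      by (simp add: inner_diff_left inner_diff_right inner_commute power2_eq_square algebra_simps)
    ultimately have "(norm (B x))\<^sup>2
        \<le> (norm x)\<^sup>2 - 2 * (c * (m * (norm x)\<^sup>2)) + c\<^sup>2 * (norm x * k)\<^sup>2" by linarith
    also have "\<dots> = (1 - m\<^sup>2 / k\<^sup>2) * (norm x)\<^sup>2"
      using k by (simp add: c_def field_simps power2_eq_square)
    also have "\<dots> \<le> \<rho>\<^sup>2 * (norm x)\<^sup>2" by (intro mult_right_mono) (auto simp: \<rho>_def)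
    finally show "(norm (B x))\<^sup>2 \<le> (\<rho> * norm x)\<^sup>2" by (simp add: power_mult_distrib)
  qed (use \<rho> in auto)
  then have "norm B < 1" using norm_blinfun_bound[OF \<rho>(1)] \<rho>(2) by fastforce
  moreover have "x \<bullet> B y = B x \<bullet> y" for x y
    using inner_symmetric_mult[OF pos_def_sym[OF S], of x y]
    by (simp add: B inner_diff_left inner_diff_right)
  ultimately obtain Y where Y: "norm Y < 1" "\<And>x y. x \<bullet> blinfun_apply Y y = Y x \<bullet> y"
      "\<And>x. 2 *\<^sub>R Y x = B x + Y (Y x)"
    by (rule symmetric_contraction_sqrt) blast
  define W where "W = matrix (\<lambda>x. x - Y x)"
  have W: "W *v x = x - Y x" for x
  proof -
    have "linear (\<lambda>x. x - Y x)"
      by (intro bounded_linear.linear bounded_linear_intros blinfun.bounded_linear_right)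
    then show ?thesis by (simp add: W_def matrix_works)
  qed
  have Wsym: "transpose W = W"
  proof -
    have "transpose W *v y = W *v y" for y
    proof (rule vector_eq_ldot[THEN iffD1], rule allI)
      fix x show "x \<bullet> (transpose W *v y) = x \<bullet> (W *v y)"
        by (simp add: inner_transpose_mult W inner_diff_left inner_diff_right Y(2))
    qed
    then show ?thesis by (simp add: matrix_eq)
  qed
  have Wpos: "x \<bullet> (W *v x) > 0" if "x \<noteq> 0" for x
  proof -
    have "x \<bullet> Y x \<le> norm x * norm (Y x)" by (rule norm_cauchy_schwarz)
    also have "\<dots> \<le> norm x * (norm Y * norm x)"
      by (intro mult_left_mono norm_blinfun) simp
    also have "\<dots> < norm x * (1 * norm x)"
      using that Y(1) by (intro mult_strict_left_mono mult_strict_right_mono) auto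
    finally show ?thesis
      by (simp add: W inner_diff_right power2_norm_eq_inner[symmetric] power2_eq_square)
  qed
  have "W *v (W *v x) = c *\<^sub>R (S *v x)" for x
    using Y(3)[of x] by (simp add: W B blinfun.bilinear_simps algebra_simps scaleR_2)
  then have WW: "W ** W = c *\<^sub>R S"
    by (simp add: matrix_eq matrix_vector_mul_assoc[symmetric] scaleR_matrix_vector_assoc)
  define X where "X = (1 / sqrt c) *\<^sub>R W"
  have "pos_def X"
    using c Wsym Wpos
    by (simp add: X_def pos_def_def transpose_scalar scaleR_matrix_vector_assoc[symmetric])
  moreover have "X ** X = S"
    using c WW by (simp add: X_def matrix_eq matrix_vector_mul_assoc[symmetric]
        scaleR_matrix_vector_assoc[symmetric] matrix_vector_mult_scaleR)
  ultimately show ?thesis by blast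
qed

lemma mat_sqrt:
  fixes S :: "real ^ 'n ^ 'n"
  assumes "pos_def S"
  shows "pos_def (mat_sqrt S)" and "mat_sqrt S ** mat_sqrt S = S"
proof -
  have "\<exists>!X. pos_def X \<and> X ** X = S"
    using pos_def_sqrt_exists[OF assms] pos_def_sqrt_unique by metis
  then have "pos_def (mat_sqrt S) \<and> mat_sqrt S ** mat_sqrt S = S"
    unfolding mat_sqrt_def by (rule theI')
  then show "pos_def (mat_sqrt S)" and "mat_sqrt S ** mat_sqrt S = S" by auto
qed

section \<open>The smallness condition on the deception intensity\<close>

text \<open>Put \<open>S = matrix_inv (mat_sqrt C)\<close>, \<open>w = S y\<close> and \<open>a = S w = C\<^sup>-\<^sup>1 y\<close>, so that
  \<open>y \<bullet> C\<^sup>-\<^sup>1 y = w \<bullet> w = y \<bullet> a\<close>.  The form of \<open>R\<close> at \<open>y - l R\<^sup>-\<^sup>1 a\<close> is nonnegative, that is,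
  \<open>2 l (w \<bullet> w) \<le> y \<bullet> R y + l\<^sup>2 (a \<bullet> R\<^sup>-\<^sup>1 a)\<close>.  The assumption, tested at \<open>w\<close>, bounds the last term by
  \<open>l (w \<bullet> w)\<close>.\<close>

lemma deception_cost_le_control_cost:
  fixes C R :: "real ^ 'n ^ 'n"
  assumes C: "pos_def C" and R: "pos_def R" and l: "l \<ge> 0"
    and small: "pos_semidef (mat 1 - l *\<^sub>R
           (matrix_inv (mat_sqrt C) ** matrix_inv R ** matrix_inv (mat_sqrt C)))"
  shows "l * (y \<bullet> (matrix_inv C *v y)) \<le> y \<bullet> (R *v y)"
proof -
  define S where "S = matrix_inv (mat_sqrt C)"
  note sqC = mat_sqrt[OF C]
  note invS = matrix_inv_cancel[OF pos_def_invertible[OF sqC(1)]]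
  note invR = matrix_inv_cancel[OF pos_def_invertible[OF R]]
  note invC = matrix_inv_cancel[OF pos_def_invertible[OF C]]
  have Ssym: "transpose S = S"
    unfolding S_def by (intro pos_def_sym pos_def_matrix_inv sqC)
  have "S ** S ** C = S ** (S ** mat_sqrt C) ** mat_sqrt C"
    by (metis matrix_mul_assoc sqC(2))
  then have "S ** S ** C = mat 1" by (simp add: S_def invS)
  then have SS: "matrix_inv C = S ** S"
    by (metis invC(1) matrix_mul_assoc matrix_mul_lid matrix_mul_rid)
  define w where "w = S *v y"
  define a where "a = S *v w"
  define z where "z = matrix_inv R *v a"
  have yC: "y \<bullet> (matrix_inv C *v y) = w \<bullet> w"
    by (simp add: SS w_def matrix_vector_mul_assoc[symmetric] inner_symmetric_mult[OF Ssym])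
  have ya: "y \<bullet> a = w \<bullet> w"
    by (simp add: a_def w_def inner_symmetric_mult[OF Ssym])
  have Rz: "R *v z = a" by (simp add: z_def matrix_vector_mul_assoc invR)
  have "w \<bullet> ((mat 1 - l *\<^sub>R (S ** matrix_inv R ** S)) *v w) \<ge> 0"
    using small by (simp add: S_def pos_semidef_def)
  moreover have "w \<bullet> ((S ** matrix_inv R ** S) *v w) = a \<bullet> z"
    by (simp add: z_def a_def matrix_vector_mul_assoc[symmetric] inner_symmetric_mult[OF Ssym])
  ultimately have "l * (a \<bullet> z) \<le> w \<bullet> w"
    by (simp add: matrix_vector_mult_diff_rdistrib inner_diff_right
        scaleR_matrix_vector_assoc[symmetric])
  then have "l * (l * (a \<bullet> z)) \<le> l * (w \<bullet> w)" using l by (rule mult_left_mono)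
  moreover have "(y - l *\<^sub>R z) \<bullet> (R *v (y - l *\<^sub>R z)) \<ge> 0"
    using pos_def_imp_pos_semidef[OF R] by (simp add: pos_semidef_def)
  moreover have "(y - l *\<^sub>R z) \<bullet> (R *v (y - l *\<^sub>R z))
      = y \<bullet> (R *v y) - 2 * (l * (w \<bullet> w)) + l * (l * (a \<bullet> z))"
  proof -
    have "z \<bullet> (R *v y) = y \<bullet> a"
      using inner_symmetric_mult[OF pos_def_sym[OF R], of z y] Rz by (simp add: inner_commute)
    then show ?thesis
      by (simp add: matrix_vector_mult_diff_distrib matrix_vector_mult_scaleR inner_diff_left
          inner_diff_right Rz ya inner_commute[of z a] algebra_simps)
  qed
  ultimately show ?thesis unfolding yC by linarith
qed

section \<open>Block matrices\<close>

lemma block_vec_cases: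
  fixes x :: "real ^ ('m::finite + 'q::finite)"
  obtains u w where "x = block_vec u w"
proof
  show "x = block_vec (\<chi> i. x $ Inl i) (\<chi> i. x $ Inr i)"
    by (auto simp: block_vec_def vec_eq_iff split: sum.split)
qed

lemma sum_UNIV_sum:
  "(\<Sum>i\<in>(UNIV :: ('m::finite + 'q::finite) set). f i) = (\<Sum>i\<in>UNIV. f (Inl i)) + (\<Sum>i\<in>UNIV. f (Inr i))"
  using sum.Plus[of "UNIV :: 'm set" "UNIV :: 'q set" f] by simp

lemma inner_block_vec [simp]:
  "block_vec u w \<bullet> block_vec u' w' = u \<bullet> u' + w \<bullet> w'"
  by (simp add: inner_vec_def sum_UNIV_sum block_vec_def)

lemma block_mat_mult_block_vec [simp]:
  "block_mat K L M N *v block_vec u w = block_vec (K *v u + L *v w) (M *v u + N *v w)"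
  by (auto simp: vec_eq_iff block_mat_def block_vec_def matrix_vector_mult_def sum_UNIV_sum
      split: sum.split)

lemma transpose_block_mat:
  "transpose (block_mat K L M N) =
     block_mat (transpose K) (transpose M) (transpose L) (transpose N)"
  by (auto simp: vec_eq_iff block_mat_def block_vec_def transpose_def split: sum.split)

lemma block_vec_eq_0_iff: "block_vec u w = 0 \<longleftrightarrow> u = 0 \<and> w = 0"
  by (simp add: vec_eq_iff block_vec_def split_sum_all)

lemma transpose_zero [simp]: "transpose (0 :: real ^ 'n ^ 'm) = 0"
  by (simp add: transpose_def vec_eq_iff)

lemma pos_semidef_block_diag:
  assumes "pos_semidef K" and "pos_semidef N"
  shows "pos_semidef (block_mat K 0 0 N)"
  unfolding pos_semidef_def
proof (intro conjI allI)
  show "transpose (block_mat K 0 0 N) = block_mat K 0 0 N"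
    using assms by (simp add: transpose_block_mat pos_semidef_def)
  fix x :: "real ^ ('a + 'b)"
  obtain u w where "x = block_vec u w" by (rule block_vec_cases)
  then show "x \<bullet> (block_mat K 0 0 N *v x) \<ge> 0"
    using assms by (simp add: pos_semidef_def)
qed

lemma pos_def_block_diag:
  assumes K: "pos_def K" and N: "pos_def N"
  shows "pos_def (block_mat K 0 0 N)"
  unfolding pos_def_def
proof (intro conjI allI impI)
  show "transpose (block_mat K 0 0 N) = block_mat K 0 0 N"
    using assms by (simp add: transpose_block_mat pos_def_def)
  fix x :: "real ^ ('a + 'b)" assume "x \<noteq> 0"
  moreover obtain u w where x: "x = block_vec u w" by (rule block_vec_cases)
  ultimately have "u \<noteq> 0 \<or> w \<noteq> 0" by (simp add: block_vec_eq_0_iff)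
  moreover have "u \<bullet> (K *v u) \<ge> 0" "w \<bullet> (N *v w) \<ge> 0"
    using pos_def_imp_pos_semidef[OF K] pos_def_imp_pos_semidef[OF N]
    by (simp_all add: pos_semidef_def)
  moreover have "u \<noteq> 0 \<Longrightarrow> u \<bullet> (K *v u) > 0" "w \<noteq> 0 \<Longrightarrow> w \<bullet> (N *v w) > 0"
    using K N by (simp_all add: pos_def_def)
  ultimately show "x \<bullet> (block_mat K 0 0 N *v x) > 0"
    unfolding x by (auto intro: add_pos_nonneg add_nonneg_pos)
qed

section \<open>One step of the Riccati recursion\<close>

text \<open>The joint form in \<open>(x, u)\<close>, evaluated at its minimizer \<open>u = - H\<^sup>-\<^sup>1 G\<^sup>T x\<close>, equals the form of the Schur
  complement at \<open>x\<close>.\<close>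

lemma pos_semidef_schur_complement:
  fixes M :: "real ^ 'n ^ 'n" and G :: "real ^ 'm ^ 'n" and H :: "real ^ 'm ^ 'm"
  assumes M: "transpose M = M" and H: "pos_def H"
    and joint: "\<And>x u. x \<bullet> (M *v x) + 2 * (x \<bullet> (G *v u)) + u \<bullet> (H *v u) \<ge> 0"
  shows "pos_semidef (M - G ** matrix_inv H ** transpose G)"
  unfolding pos_semidef_def
proof (intro conjI allI)
  show "transpose (M - G ** matrix_inv H ** transpose G) = M - G ** matrix_inv H ** transpose G"
    by (simp add: transpose_diff M matrix_transpose_mul matrix_mul_assoc
        pos_def_sym[OF pos_def_matrix_inv[OF H]])
  fix x
  define u where "u = matrix_inv H *v (transpose G *v x)"
  have Hu: "H *v u = transpose G *v x"
    unfolding u_def matrix_vector_mul_assoc[of H]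
    by (simp add: matrix_inv_cancel[OF pos_def_invertible[OF H]])
  have "u \<bullet> (H *v u) = x \<bullet> (G *v u)"
    by (simp add: Hu inner_transpose_mult inner_commute)
  then have "x \<bullet> (M *v x) - x \<bullet> (G *v u) \<ge> 0"
    using joint[of x "- u"] by (simp add: mult_minus_right linear_neg)
  then show "x \<bullet> ((M - G ** matrix_inv H ** transpose G) *v x) \<ge> 0"
    by (simp add: u_def matrix_vector_mult_diff_rdistrib inner_diff_right matrix_vector_mul_assoc
        matrix_mul_assoc)
qed

text \<open>The cost is written as the sum of the forms of \<open>R_v\<close> and \<open>R_alpha\<close>, a square in
  \<open>F_b v + F_c b - \<beta>\<close> weighted by the inverse of \<open>cov_y\<close>, and a remainder in \<open>\<beta>\<close> that is nonnegative
  by \<open>small\<close>.\<close>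

lemma stage_cost_nonneg:
  fixes p :: "'n::finite lq_data"
  assumes W: "pos_semidef (matrix_inv (cov_y p))" and Ra: "pos_semidef (R_alpha p)"
    and Rv: "pos_semidef (R_v p)" and l: "lam p \<ge> 0"
    and small: "\<And>y. lam p * (y \<bullet> (matrix_inv (cov_y p) *v y)) \<le> y \<bullet> (R_beta p *v y)"
  shows "x \<bullet> (Q_mat p t *v x) + 2 * (x \<bullet> (N_mat p t *v u)) + u \<bullet> (R_mat p *v u) \<ge> 0"
proof -
  obtain v b where x: "x = block_vec v b" by (rule block_vec_cases)
  obtain \<alpha> \<beta> where u: "u = block_vec \<alpha> \<beta>" by (rule block_vec_cases)
  define W where "W = matrix_inv (cov_y p)"
  define f where "f = F_b p t *v v"
  define g where "g = F_c p t *v b"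
  have Wsym: "y \<bullet> (W *v z) = z \<bullet> (W *v y)" for y z
    using W inner_symmetric_mult[of W y z] by (simp add: W_def pos_semidef_def inner_commute)
  have Q: "x \<bullet> (Q_mat p t *v x) = v \<bullet> (R_v p *v v) + lam p * ((f + g) \<bullet> (W *v (f + g)))"
    by (simp add: x Q_mat_def W_def[symmetric] f_def g_def matrix_vector_mult_add_rdistrib
        matrix_vector_right_distrib scaleR_matrix_vector_assoc[symmetric] inner_add_left
        inner_add_right matrix_vector_mul_assoc[symmetric] inner_transpose_mult distrib_left)
  have neg: "(- A) *v z = - (A *v z)" for A :: "real ^ 'n ^ 'n" and z
    by (simp add: vec_eq_iff matrix_vector_mult_def sum_negf)
  have N: "x \<bullet> (N_mat p t *v u) = - lam p * ((f + g) \<bullet> (W *v \<beta>))"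
    by (simp add: x u N_mat_def W_def[symmetric] f_def g_def neg
        scaleR_matrix_vector_assoc[symmetric] inner_add_left
        matrix_vector_mul_assoc[symmetric] inner_transpose_mult distrib_left)
  have R: "u \<bullet> (R_mat p *v u) = \<alpha> \<bullet> (R_alpha p *v \<alpha>) + \<beta> \<bullet> (R_beta p *v \<beta>)"
    by (simp add: u R_mat_def)
  have "(f + g - \<beta>) \<bullet> (W *v (f + g - \<beta>)) =
      (f + g) \<bullet> (W *v (f + g)) - 2 * ((f + g) \<bullet> (W *v \<beta>)) + \<beta> \<bullet> (W *v \<beta>)"
    using Wsym[of \<beta> "f + g"]
    by (simp add: matrix_vector_mult_diff_distrib inner_diff_left inner_diff_right)
  then have "x \<bullet> (Q_mat p t *v x) + 2 * (x \<bullet> (N_mat p t *v u)) + u \<bullet> (R_mat p *v u) =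
      v \<bullet> (R_v p *v v) + \<alpha> \<bullet> (R_alpha p *v \<alpha>)
      + lam p * ((f + g - \<beta>) \<bullet> (W *v (f + g - \<beta>)))
      + (\<beta> \<bullet> (R_beta p *v \<beta>) - lam p * (\<beta> \<bullet> (W *v \<beta>)))"
    unfolding Q N R by (simp add: algebra_simps)
  moreover have "lam p * ((f + g - \<beta>) \<bullet> (W *v (f + g - \<beta>))) \<ge> 0"
    using W l by (simp add: W_def pos_semidef_def)
  ultimately show ?thesis
    using Ra Rv small[of \<beta>] by (simp add: W_def pos_semidef_def)
qed

lemma transpose_Q_mat:
  assumes "transpose (matrix_inv (cov_y p)) = matrix_inv (cov_y p)"
    and "transpose (R_v p) = R_v p"
  shows "transpose (Q_mat p t) = Q_mat p t"
  by (simp add: Q_mat_def transpose_block_mat transpose_add transpose_scalar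
      matrix_transpose_mul assms matrix_mul_assoc)

text \<open>The joint form of \<open>M_mat\<close>, \<open>G_mat\<close> and \<open>H_mat\<close> is the stage cost plus the form of \<open>P'\<close> at the successor
  state \<open>A x + B u\<close>.\<close>

lemma pos_semidef_riccati_step:
  fixes p :: "'n::finite lq_data"
  assumes W: "pos_semidef (matrix_inv (cov_y p))" and Rv: "pos_semidef (R_v p)"
    and cost: "\<And>x u. x \<bullet> (Q_mat p t *v x) + 2 * (x \<bullet> (N_mat p t *v u)) + u \<bullet> (R_mat p *v u) \<ge> 0"
    and P': "pos_semidef P'" and H: "pos_def (H_mat p P')"
  shows "pos_semidef (M_mat p t P' - G_mat p t P' ** matrix_inv (H_mat p P')
           ** transpose (G_mat p t P'))"
proof (rule pos_semidef_schur_complement[OF _ H])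
  have P'sym: "transpose P' = P'" using P' by (simp add: pos_semidef_def)
  show "transpose (M_mat p t P') = M_mat p t P'"
    using W Rv P'sym
    by (simp add: M_mat_def transpose_add transpose_Q_mat pos_semidef_def
        matrix_transpose_mul matrix_mul_assoc)
  fix x u
  have "(A_mat *v x + u) \<bullet> (P' *v (A_mat *v x + u)) \<ge> 0"
    using P' by (simp add: pos_semidef_def)
  moreover have "(A_mat *v x + u) \<bullet> (P' *v (A_mat *v x + u)) =
      x \<bullet> ((transpose A_mat ** P' ** A_mat) *v x)
      + 2 * (x \<bullet> ((transpose A_mat ** P' ** B_mat) *v u))
      + u \<bullet> ((transpose B_mat ** P' ** B_mat) *v u)"
    using inner_symmetric_mult[OF P'sym, of u "A_mat *v x"]
    by (simp add: B_mat_def matrix_vector_mul_assoc[symmetric] inner_transpose_mult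
        matrix_vector_right_distrib inner_add_left inner_add_right inner_commute)
  ultimately show "x \<bullet> (M_mat p t P' *v x) + 2 * (x \<bullet> (G_mat p t P' *v u))
      + u \<bullet> (H_mat p P' *v u) \<ge> 0"
    using cost[of x u]
    by (simp add: M_mat_def G_mat_def H_mat_def matrix_vector_mult_add_rdistrib
        inner_add_right algebra_simps)
qed

section \<open>Solving a backward recursion\<close>

text \<open>Reversing time by \<open>t \<mapsto> T - t\<close> turns this into primitive recursion.\<close>

lemma backward_recursion_exists:
  fixes step :: "nat \<Rightarrow> 'a \<Rightarrow> 'a"
  shows "\<exists>W. W T = z \<and> (\<forall>t<T. W t = step t (W (t + 1)))"
proof -
  define V where "V = rec_nat z (\<lambda>k. step (T - Suc k))"
  have "V (T - t) = step t (V (T - (t + 1)))" if "t < T" for t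
  proof -
    have "T - t = Suc (T - (t + 1))" using that by simp
    then show ?thesis using that by (simp add: V_def)
  qed
  then show ?thesis by (intro exI[of _ "\<lambda>t. V (T - t)"]) (simp add: V_def)
qed

lemma backward_induct [consumes 1, case_names last step]:
  assumes "(t::nat) \<le> T" and "Q T" and "\<And>t. t < T \<Longrightarrow> Q (t + 1) \<Longrightarrow> Q t"
  shows "Q t"
  using assms(1,2) by (rule inc_induct) (use assms(3) in simp)

lemma backward_solution_exists: "\<exists>P s c. backward_solution p T P s c"
proof -
  define step where "step t = (\<lambda>(P', s', c').
        let G = G_mat p t P';
            Hinv = matrix_inv (H_mat p P');
            w = r_vec p t + transpose B_mat *v s'
        in (M_mat p t P' - G ** Hinv ** transpose G,
            q_vec p t + transpose A_mat *v s' - (G ** Hinv) *v w,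
            d_coeff p t + c' - 1/2 * (w \<bullet> (Hinv *v w))
              + 1/2 * trace (P' ** block_mat (cov_z p) 0 0 (cov_y p))))" for t
  obtain V where V: "V T = (block_mat (T_v p) 0 0 0, block_vec (- (transpose (T_v p) *v v_ref p T)) 0,
      1/2 * (v_ref p T \<bullet> (T_v p *v v_ref p T)))" "\<And>t. t < T \<Longrightarrow> V t = step t (V (t + 1))"
    using backward_recursion_exists by metis
  have "backward_solution p T (\<lambda>t. fst (V t)) (\<lambda>t. fst (snd (V t))) (\<lambda>t. snd (snd (V t)))"
    unfolding backward_solution_def Let_def
    by (simp add: V step_def Let_def split_beta)
  then show ?thesis by blast
qed

lemma backward_solution_step:
  assumes "backward_solution p T P s c" and "t < T"
  defines "G \<equiv> G_mat p t (P (t + 1))"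
    and "Hinv \<equiv> matrix_inv (H_mat p (P (t + 1)))"
    and "w \<equiv> r_vec p t + transpose B_mat *v s (t + 1)"
  shows "P t = M_mat p t (P (t + 1)) - G ** Hinv ** transpose G"
    and "s t = q_vec p t + transpose A_mat *v s (t + 1) - (G ** Hinv) *v w"
    and "c t = d_coeff p t + c (t + 1) - 1/2 * (w \<bullet> (Hinv *v w))
           + 1/2 * trace (P (t + 1) ** block_mat (cov_z p) 0 0 (cov_y p))"
  using assms(1,2) unfolding backward_solution_def Let_def G_def Hinv_def w_def by blast+

lemma backward_solution_unique:
  assumes sol: "backward_solution p T P s c" and sol': "backward_solution p T P' s' c'"
    and "t \<le> T"
  shows "P' t = P t \<and> s' t = s t \<and> c' t = c t"
  using \<open>t \<le> T\<close>
proof (induction rule: backward_induct)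
  case last
  then show ?case using sol sol' by (simp add: backward_solution_def)
next
  case (step t)
  then show ?case
    by (simp only: backward_solution_step[OF sol \<open>t < T\<close>] backward_solution_step[OF sol' \<open>t < T\<close>])
qed

section \<open>Well-posedness of the backward recursions\<close>

theorem theorem1:
  fixes p :: "'n::finite lq_data" and T :: nat
  assumes "pos_def (cov_z p)" and "pos_def (cov_y p)"
    and "pos_def (R_alpha p)" and "pos_def (R_beta p)"
    and "pos_def (R_v p)" and "pos_def (T_v p)"
    and "lam p \<ge> 0"
    and "pos_semidef (mat 1 - lam p *\<^sub>R
           (matrix_inv (mat_sqrt (cov_y p)) ** matrix_inv (R_beta p) ** matrix_inv (mat_sqrt (cov_y p))))"
  shows "\<exists>P s c. backward_solution p T P s c \<and>
           (\<forall>t<T. invertible (H_mat p (P (t + 1)))) \<and>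
           (\<forall>P' s' c'. backward_solution p T P' s' c' \<longrightarrow>
              (\<forall>t\<le>T. P' t = P t \<and> s' t = s t \<and> c' t = c t))"
proof -
  obtain P s c where sol: "backward_solution p T P s c"
    using backward_solution_exists by blast
  have W: "pos_semidef (matrix_inv (cov_y p))"
    by (intro pos_def_imp_pos_semidef pos_def_matrix_inv assms)
  have Rv: "pos_semidef (R_v p)" by (intro pos_def_imp_pos_semidef assms)
  have cost: "x \<bullet> (Q_mat p t *v x) + 2 * (x \<bullet> (N_mat p t *v u)) + u \<bullet> (R_mat p *v u) \<ge> 0" for t x u
    by (intro stage_cost_nonneg W Rv pos_def_imp_pos_semidef[OF assms(3)] assms(7)
        deception_cost_le_control_cost assms)
  have H: "pos_def (H_mat p P')" if "pos_semidef P'" for P'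
    using pos_def_add_pos_semidef[OF pos_def_block_diag[OF assms(3,4)] that]
    by (simp add: H_mat_def R_mat_def B_mat_def)
  have P: "pos_semidef (P t)" if "t \<le> T" for t
    using that
  proof (induction rule: backward_induct)
    case last
    have "pos_semidef (0 :: real ^ 'n ^ 'n)" by (simp add: pos_semidef_def)
    then show ?case
      using sol pos_semidef_block_diag[OF pos_def_imp_pos_semidef[OF assms(6)]]
      by (simp add: backward_solution_def)
  next
    case (step t)
    then show ?case
      unfolding backward_solution_step(1)[OF sol \<open>t < T\<close>]
      by (intro pos_semidef_riccati_step W Rv cost H)
  qed
  have "invertible (H_mat p (P (t + 1)))" if "t < T" for t
    using that by (intro pos_def_invertible H P) simp
  with sol backward_solution_unique[OF sol] show ?thesis by blast
qed

end
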